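(* Let $C\in\mathbb{R}^{n\times n}$, $\varepsilon>0$, and $K=\exp(-C/\varepsilon)$ (entrywise), so that $K_{ij}>0$ for all $i,j$. Let $a,b\in\mathbb{R}^n_{++}$ with $\mathbf{1}^\top a=\mathbf{1}^\top b$. Let $n=cm$ and let $\mathcal{I}_1,\dots,\mathcal{I}_c$ be a partition of $\{1,\dots,n\}$ into sets of size $m$. Suppose that the centralized Sinkhorn--Knopp iteration, the synchronous All-to-All federated Sinkhorn algorithm and the synchronous Star-Network federated Sinkhorn algorithm (all three defined in the context) are initialized identically, with the same vectors $(u^0,v^0)\in\mathbb{R}^n_{++}\times\mathbb{R}^n_{++}$. Then both federated algorithms generate exactly the same sequence of global iterates $(u^t,v^t)_{t\ge 0}$ as the centralized Sinkhorn--Knopp iteration. Consequently, $(u^t,v^t)$ converges linearly in the Hilbert projective metric to the fixed point $(u^\star,v^\star)\in\mathbb{R}^n_{++}\times\mathbb{R}^n_{++}$ of the Sinkhorn iteration, i.e. $u^\star=a\oslash(Kv^\star)$ and $v^\star=b\oslash(K^\top u^\star)$, which is unique up to the rescaling $(u^\star,v^\star)\sim(s^{-1}u^\star,s\,v^\star)$, $s>0$; that is, there are constants $M\ge 0$ and $\gamma\in(0,1)$ with $d_{\mathrm H}(u^t,u^\star)\le M\gamma^t$ and $d_{\mathrm H}(v^t,v^\star)\le M\gamma^t$ for all $t\ge 0$. Moreover $P^\star=\mathrm{diag}(u^\star)\,K\,\mathrm{diag}(v^\star)$ solves the entropic optimal transport problem $$\min_{P\in\mathbb{R}^{n\times n}_+}\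 \langle P,C\rangle+\varepsilon\sum_{i,j=1}^n P_{ij}(\log P_{ij}-1)\quad\text{subject to}\quad P\mathbf{1}=a,\ P^\top\mathbf{1}=b.$$
   Context: Notation: $\mathbb{R}^n_{++}$ is the set of vectors with strictly positive entries; $\oslash$ is elementwise division; $\mathbf{1}$ is the all-ones vector; $0\log 0=0$; $\langle P,C\rangle=\sum_{i,j}P_{ij}C_{ij}$. For an index set $\mathcal{I}$, $x_{\mathcal{I}}$ is the subvector of $x$ indexed by $\mathcal{I}$, and $K_{\mathcal{I},:}$, $K_{:,\mathcal{I}}$ are the corresponding row and column blocks of $K$. All computations are in exact arithmetic. Hilbert projective metric: for $x,y\in\mathbb{R}^n_{++}$, $d_{\mathrm H}(x,y)=\log\bigl(\max_i x_i/y_i\bigr)-\log\bigl(\min_i x_i/y_i\bigr)$. Centralized Sinkhorn--Knopp iteration: $u^{t+1}=a\oslash(Kv^t)$, $v^{t+1}=b\oslash(K^\top u^{t+1})$, $t\ge 0$. There are $c$ clients; client $j$ owns the index set $\mathcal{I}_j$ and the marginal slices $a_j=a_{\mathcal{I}_j}$, $b_j=b_{\mathcal{I}_j}$. Synchronous All-to-All federated Sinkhorn: every client holds a copy of the global vectors $u,v$, identical at all clients at initialization (by default $u=v=\mathbf{1}$). In each iteration, every client $j$ (1) computes $q_{\mathcal{I}_j}\leftarrow K_{\mathcal{I}_j,:}v$; (2) sets $u_{\mathcal{I}_j}\leftarrow a_j\oslash q_{\mathcal{I}_j}$; (3) all clients perform an Allgather of the slices $u_{\mathcal{I}_j}$,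 after which each client holds the concatenated global $u$; (4) computes $r_{\mathcal{I}_j}\leftarrow(K_{:,\mathcal{I}_j})^\top u$; (5) sets $v_{\mathcal{I}_j}\leftarrow b_j\oslash r_{\mathcal{I}_j}$; (6) all clients perform an Allgather of the slices $v_{\mathcal{I}_j}$, after which each client holds the concatenated global $v$. The global iterate $(u^t,v^t)$ is the concatenation of all slices after $t$ iterations. Synchronous Star-Network federated Sinkhorn: a server holds $K$ and initializes $u,v$ (by default $u=v=\mathbf{1}$). In each iteration: (1) each client $j$ sends $v_{\mathcal{I}_j}$ to the server; (2) the server assembles $v$, computes $q\leftarrow Kv$ and broadcasts $q$ to all clients; (3) each client $j$ sets $u_{\mathcal{I}_j}\leftarrow a_j\oslash q_{\mathcal{I}_j}$ and sends $u_{\mathcal{I}_j}$ to the server; (4) the server assembles $u$, computes $r\leftarrow K^\top u$ and broadcasts $r$ to all clients; (5) each client $j$ sets $v_{\mathcal{I}_j}\leftarrow b_j\oslash r_{\mathcal{I}_j}$. The global iterate $(u^t,v^t)$ is the concatenation of all slices after $t$ iterations. *)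

theory Defs
  imports "HOL-Analysis.Analysis"
begin

definition pos_vec :: "real ^ 'n \<Rightarrow> bool" where
  "pos_vec x \<longleftrightarrow> (\<forall>i. 0 < x $ i)"

definition ediv :: "real ^ 'n \<Rightarrow> real ^ 'n \<Rightarrow> real ^ 'n"  (infixl "\<oslash>" 70) where
  "x \<oslash> y = (\<chi> i. x $ i / y $ i)"

definition diag_mat :: "real ^ 'n \<Rightarrow> real ^ 'n ^ 'n" where
  "diag_mat x = (\<chi> i j. if i = j then x $ i else 0)"

definition gibbs_kernel :: "real ^ 'n ^ 'n \<Rightarrow> real \<Rightarrow> real ^ 'n ^ 'n" where
  "gibbs_kernel C \<epsilon> = (\<chi> i j. exp (- C $ i $ j / \<epsilon>))"

definition hilbert_dist :: "real ^ 'n \<Rightarrow> real ^ 'n \<Rightarrow> real" where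
  "hilbert_dist x y = ln (MAX i. x $ i / y $ i) - ln (MIN i. x $ i / y $ i)"

primrec sinkhorn ::
  "real ^ 'n ^ 'n \<Rightarrow> real ^ 'n \<Rightarrow> real ^ 'n \<Rightarrow> real ^ 'n \<Rightarrow> real ^ 'n
    \<Rightarrow> nat \<Rightarrow> (real ^ 'n) \<times> (real ^ 'n)" where
  "sinkhorn K a b u0 v0 0 = (u0, v0)"
| "sinkhorn K a b u0 v0 (Suc t) =
    (let v = snd (sinkhorn K a b u0 v0 t);
         u' = a \<oslash> (K *v v);
         v' = b \<oslash> (transpose K *v u')
     in (u', v'))"

definition sinkhorn_fixed_point ::
  "real ^ 'n ^ 'n \<Rightarrow> real ^ 'n \<Rightarrow> real ^ 'n \<Rightarrow> real ^ 'n \<Rightarrow> real ^ 'n \<Rightarrow> bool" where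
  "sinkhorn_fixed_point K a b u v \<longleftrightarrow>
     pos_vec u \<and> pos_vec v \<and> u = a \<oslash> (K *v v) \<and> v = b \<oslash> (transpose K *v u)"

text \<open>
  The subvector indexed by \<open>J\<close> is an extensional function on \<open>J\<close>: it is \<open>undefined\<close> outside \<open>J\<close>,
  so it carries no entry belonging to another client.
\<close>

definition slice :: "real ^ 'n \<Rightarrow> 'n set \<Rightarrow> 'n \<Rightarrow> real" where
  "slice x J = (\<lambda>i\<in>J. x $ i)"

definition slice_div :: "'n set \<Rightarrow> ('n \<Rightarrow> real) \<Rightarrow> ('n \<Rightarrow> real) \<Rightarrow> 'n \<Rightarrow> real" where
  "slice_div J x y = (\<lambda>i\<in>J. x i / y i)"

definition row_block_mult :: "real ^ 'n ^ 'n \<Rightarrow> 'n set \<Rightarrow> real ^ 'n \<Rightarrow> 'n \<Rightarrow> real" where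
  "row_block_mult K J v = (\<lambda>i\<in>J. \<Sum>k\<in>UNIV. K $ i $ k * v $ k)"

definition col_block_tmult :: "real ^ 'n ^ 'n \<Rightarrow> 'n set \<Rightarrow> real ^ 'n \<Rightarrow> 'n \<Rightarrow> real" where
  "col_block_tmult K J u = (\<lambda>k\<in>J. \<Sum>i\<in>UNIV. K $ i $ k * u $ i)"

text \<open>Concatenation of slices: entry \<open>i\<close> is taken from the unique client owning \<open>i\<close>.\<close>

definition assemble :: "('c \<Rightarrow> 'n set) \<Rightarrow> ('c \<Rightarrow> 'n \<Rightarrow> real) \<Rightarrow> real ^ 'n" where
  "assemble I s = (\<chi> i. s (THE j. i \<in> I j) i)"

definition allgather :: "('c \<Rightarrow> 'n set) \<Rightarrow> ('c \<Rightarrow> 'n \<Rightarrow> real) \<Rightarrow> 'c \<Rightarrow> real ^ 'n" where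
  "allgather I s = (\<lambda>j. assemble I s)"

definition broadcast :: "real ^ 'n \<Rightarrow> 'c \<Rightarrow> real ^ 'n" where
  "broadcast x = (\<lambda>j. x)"

text \<open>
  All-to-All: \<open>U j\<close> and \<open>V j\<close> are the copies of the global vectors held by client \<open>j\<close>.
\<close>

definition all_to_all_step ::
  "real ^ 'n ^ 'n \<Rightarrow> real ^ 'n \<Rightarrow> real ^ 'n \<Rightarrow> ('c \<Rightarrow> 'n set)
    \<Rightarrow> ('c \<Rightarrow> real ^ 'n) \<times> ('c \<Rightarrow> real ^ 'n) \<Rightarrow> ('c \<Rightarrow> real ^ 'n) \<times> ('c \<Rightarrow> real ^ 'n)" where
  "all_to_all_step K a b I = (\<lambda>(U, V).
     let q = (\<lambda>j. row_block_mult K (I j) (V j));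
         us = (\<lambda>j. slice_div (I j) (slice a (I j)) (q j));
         U' = allgather I us;
         r = (\<lambda>j. col_block_tmult K (I j) (U' j));
         vs = (\<lambda>j. slice_div (I j) (slice b (I j)) (r j));
         V' = allgather I vs
     in (U', V'))"

definition all_to_all_sinkhorn ::
  "real ^ 'n ^ 'n \<Rightarrow> real ^ 'n \<Rightarrow> real ^ 'n \<Rightarrow> ('c \<Rightarrow> 'n set) \<Rightarrow> real ^ 'n \<Rightarrow> real ^ 'n
    \<Rightarrow> nat \<Rightarrow> (real ^ 'n) \<times> (real ^ 'n)" where
  "all_to_all_sinkhorn K a b I u0 v0 t =
    (let (U, V) = (all_to_all_step K a b I ^^ t) (\<lambda>j. u0, \<lambda>j. v0)
     in (assemble I (\<lambda>j. slice (U j) (I j)), assemble I (\<lambda>j. slice (V j) (I j))))"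

text \<open>
  Star network: \<open>us j\<close> and \<open>vs j\<close> are the slices held by client \<open>j\<close>; the global vectors are
  formed only at the server.
\<close>

definition star_step ::
  "real ^ 'n ^ 'n \<Rightarrow> real ^ 'n \<Rightarrow> real ^ 'n \<Rightarrow> ('c \<Rightarrow> 'n set)
    \<Rightarrow> ('c \<Rightarrow> 'n \<Rightarrow> real) \<times> ('c \<Rightarrow> 'n \<Rightarrow> real) \<Rightarrow> ('c \<Rightarrow> 'n \<Rightarrow> real) \<times> ('c \<Rightarrow> 'n \<Rightarrow> real)" where
  "star_step K a b I = (\<lambda>(us, vs).
     let v = assemble I vs;
         q = broadcast (K *v v);
         us' = (\<lambda>j. slice_div (I j) (slice a (I j)) (slice (q j) (I j)));
         u = assemble I us';
         r = broadcast (transpose K *v u);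
         vs' = (\<lambda>j. slice_div (I j) (slice b (I j)) (slice (r j) (I j)))
     in (us', vs'))"

definition star_sinkhorn ::
  "real ^ 'n ^ 'n \<Rightarrow> real ^ 'n \<Rightarrow> real ^ 'n \<Rightarrow> ('c \<Rightarrow> 'n set) \<Rightarrow> real ^ 'n \<Rightarrow> real ^ 'n
    \<Rightarrow> nat \<Rightarrow> (real ^ 'n) \<times> (real ^ 'n)" where
  "star_sinkhorn K a b I u0 v0 t =
    (let (us, vs) = (star_step K a b I ^^ t) (\<lambda>j. slice u0 (I j), \<lambda>j. slice v0 (I j))
     in (assemble I us, assemble I vs))"

definition transport_plan :: "real ^ 'n \<Rightarrow> real ^ 'n \<Rightarrow> real ^ 'n ^ 'n \<Rightarrow> bool" where
  "transport_plan a b P \<longleftrightarrow> (\<forall>i j. 0 \<le> P $ i $ j) \<and> P *v 1 = a \<and> transpose P *v 1 = b"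

text \<open>At \<open>P $ i $ j = 0\<close> the entropy summand is \<open>0\<close>, in accordance with \<open>0 log 0 = 0\<close>.\<close>

definition entropic_cost :: "real ^ 'n ^ 'n \<Rightarrow> real \<Rightarrow> real ^ 'n ^ 'n \<Rightarrow> real" where
  "entropic_cost C \<epsilon> P =
     (\<Sum>i\<in>UNIV. \<Sum>j\<in>UNIV. P $ i $ j * C $ i $ j)
     + \<epsilon> * (\<Sum>i\<in>UNIV. \<Sum>j\<in>UNIV. P $ i $ j * (ln (P $ i $ j) - 1))"

definition solves_entropic_ot ::
  "real ^ 'n ^ 'n \<Rightarrow> real \<Rightarrow> real ^ 'n \<Rightarrow> real ^ 'n \<Rightarrow> real ^ 'n ^ 'n \<Rightarrow> bool" where
  "solves_entropic_ot C \<epsilon> a b P \<longleftrightarrow> is_arg_min (entropic_cost C \<epsilon>) (transport_plan a b) P"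

end

theory Submission
  imports Defs
begin

text \<open>
  Existence of a fixed point is Brouwer's theorem for the normalised map
  \<open>v \<mapsto> b \<oslash> (K\<^sup>T (a \<oslash> (K v)))\<close> on the simplex; equality of the total masses of \<open>a\<close> and \<open>b\<close> forces
  the normalisation factor to be \<open>1\<close>. For contraction we do not use Birkhoff's constant. If the
  ratios \<open>x\<^sub>i / y\<^sub>i\<close> lie in \<open>[\<mu>, (1 + \<theta>) \<mu>]\<close>, then the ratios of \<open>K x\<close> and \<open>K y\<close> are weighted
  averages of them, whose weights have a common part of mass \<open>\<delta> > 0\<close>. Averaging therefore replaces \<open>\<theta>\<close>
  by \<open>(1 - \<delta>) \<theta>\<close>, whereas \<open>x \<mapsto> a \<oslash> x\<close> preserves \<open>\<theta>\<close>, and the Hilbert distance is at most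
  \<open>ln (1 + \<theta>) \<le> \<theta>\<close>. Optimality of the plan follows from the tangent inequality for \<open>p ln p - p\<close>,
  because \<open>C\<^sub>i\<^sub>j + \<epsilon> ln P\<^sub>i\<^sub>j\<close> is a sum of a row term and a column term.
\<close>

subsection \<open>Federated iterations\<close>

text \<open>Disjointness makes the description operator in \<open>assemble\<close> pick the owner of
  \<open>i\<close>, and covering provides an owner, so the \<open>undefined\<close> values outside a
  slice are never read.\<close>

lemma assemble_restrict:
  assumes "disjoint_family I" "(\<Union>j. I j) = UNIV"
  shows "assemble I (\<lambda>j. \<lambda>i\<in>I j. f i) = (\<chi> i. f i)"
proof -
  have "(if i \<in> I (THE j. i \<in> I j) then f i else undefined) = f i" for i
  proof -
    obtain j where j: "i \<in> I j" using assms(2) by blast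
    have "(THE j. i \<in> I j) = j"
      using j assms(1) by (intro the_equality) (auto simp: disjoint_family_on_def)
    thus ?thesis using j by simp
  qed
  thus ?thesis by (simp add: assemble_def vec_eq_iff)
qed

lemma assemble_slice:
  assumes "disjoint_family I" "(\<Union>j. I j) = UNIV"
  shows "assemble I (\<lambda>j. slice x (I j)) = x"
  using assemble_restrict[OF assms, of "\<lambda>i. x $ i"] by (simp add: slice_def)

lemma assemble_slice_div:
  assumes "disjoint_family I" "(\<Union>j. I j) = UNIV"
  shows "assemble I (\<lambda>j. slice_div (I j) (slice x (I j)) (\<lambda>i\<in>I j. y $ i)) = x \<oslash> y"
proof -
  have "slice_div J (slice x J) (\<lambda>i\<in>J. y $ i) = (\<lambda>i\<in>J. x $ i / y $ i)" for J
    by (auto simp: slice_div_def slice_def fun_eq_iff)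
  thus ?thesis
    using assemble_restrict[OF assms, of "\<lambda>i. x $ i / y $ i"] by (simp add: ediv_def)
qed

lemma row_block_mult_eq: "row_block_mult K J v = (\<lambda>i\<in>J. (K *v v) $ i)"
  by (simp add: row_block_mult_def matrix_vector_mult_def)

lemma col_block_tmult_eq: "col_block_tmult K J u = (\<lambda>i\<in>J. (transpose K *v u) $ i)"
  by (simp add: col_block_tmult_def matrix_vector_mult_def transpose_def)

text \<open>The invariant is that all clients hold the same pair of vectors: an Allgather hands
  everyone the same concatenation, so constant families stay constant.\<close>

lemma all_to_all_sinkhorn_eq:
  assumes "disjoint_family I" "(\<Union>j. I j) = UNIV"
  shows "all_to_all_sinkhorn K a b I u0 v0 t = sinkhorn K a b u0 v0 t"
proof -
  have step: "all_to_all_step K a b I (\<lambda>j. u, \<lambda>j. v)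
      = (\<lambda>j. a \<oslash> (K *v v), \<lambda>j. b \<oslash> (transpose K *v (a \<oslash> (K *v v))))" for u v
    by (simp add: all_to_all_step_def Let_def allgather_def row_block_mult_eq col_block_tmult_eq
        assemble_slice_div[OF assms])
  have "(all_to_all_step K a b I ^^ t) (\<lambda>j. u0, \<lambda>j. v0)
      = (\<lambda>j. fst (sinkhorn K a b u0 v0 t), \<lambda>j. snd (sinkhorn K a b u0 v0 t))"
    by (induction t) (simp_all add: step Let_def)
  thus ?thesis by (simp add: all_to_all_sinkhorn_def assemble_slice[OF assms])
qed

text \<open>The state consists of slices, so the invariant concerns the assembled state. A round
  depends on the slices only through the assembled \<open>v\<close>.\<close>

lemma star_sinkhorn_eq:
  assumes "disjoint_family I" "(\<Union>j. I j) = UNIV"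
  shows "star_sinkhorn K a b I u0 v0 t = sinkhorn K a b u0 v0 t"
proof -
  have slice: "slice y J = (\<lambda>i\<in>J. y $ i)" for y J by (simp add: slice_def)
  have step: "map_prod (assemble I) (assemble I) (star_step K a b I s)
      = (let u = a \<oslash> (K *v assemble I (snd s)) in (u, b \<oslash> (transpose K *v u)))" for s
    by (simp add: star_step_def Let_def broadcast_def assemble_slice_div[OF assms, folded slice]
        split: prod.split)
  have "map_prod (assemble I) (assemble I)
      ((star_step K a b I ^^ t) (\<lambda>j. slice u0 (I j), \<lambda>j. slice v0 (I j))) = sinkhorn K a b u0 v0 t"
  proof (induction t)
    case (Suc t)
    show ?case by (simp add: step Let_def flip: Suc.IH)
  qed (simp add: assemble_slice[OF assms])
  thus ?thesis by (simp add: star_sinkhorn_def case_prod_unfold map_prod_def)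
qed

subsection \<open>Contraction\<close>

text \<open>For positive vectors and \<open>0 \<le> \<theta>\<close> this is
  \<open>hilbert_dist x y \<le> ln (1 + \<theta>)\<close> with denominators cleared.\<close>

definition ratio_spread_le :: "real ^ 'n \<Rightarrow> real ^ 'n \<Rightarrow> real \<Rightarrow> bool" where
  "ratio_spread_le x y \<theta> \<longleftrightarrow> (\<forall>i k. x $ i * y $ k \<le> (1 + \<theta>) * (x $ k * y $ i))"

lemma ratio_spread_leD: "ratio_spread_le x y \<theta> \<Longrightarrow> x $ i * y $ k \<le> (1 + \<theta>) * (x $ k * y $ i)"
  by (simp add: ratio_spread_le_def)

lemma ratio_spread_le_mono:
  assumes "pos_vec x" "pos_vec y" "ratio_spread_le x y \<theta>" "\<theta> \<le> \<theta>'"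
  shows "ratio_spread_le x y \<theta>'"
  unfolding ratio_spread_le_def
proof (intro allI)
  fix i k
  have "(1 + \<theta>) * (x $ k * y $ i) \<le> (1 + \<theta>') * (x $ k * y $ i)"
    using assms by (intro mult_right_mono) (auto simp: pos_vec_def less_imp_le)
  thus "x $ i * y $ k \<le> (1 + \<theta>') * (x $ k * y $ i)"
    using ratio_spread_leD[OF assms(3)] by (meson order_trans)
qed

lemma ex_ratio_spread_le:
  fixes x y :: "real ^ 'n"
  assumes "pos_vec x" "pos_vec y"
  shows "\<exists>\<theta>\<ge>0. ratio_spread_le x y \<theta>"
proof -
  define f where "f = (\<lambda>(i, k). x $ i * y $ k / (x $ k * y $ i))"
  define \<theta> where "\<theta> = Max (range f)"
  have le: "f p \<le> \<theta>" for p unfolding \<theta>_def by (intro Max_ge) auto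
  have pos: "0 < x $ i" "0 < y $ i" for i using assms by (auto simp: pos_vec_def)
  have bound: "x $ i * y $ k \<le> \<theta> * (x $ k * y $ i)" for i k
    using le[of "(i, k)"] pos[of i] pos[of k] by (simp add: f_def pos_divide_le_eq)
  have "0 \<le> \<theta>"
    using le[of "(undefined, undefined)"] pos[of undefined] by (simp add: f_def)
  moreover have "ratio_spread_le x y \<theta>"
    unfolding ratio_spread_le_def
  proof (intro allI)
    fix i k
    have "0 \<le> x $ k * y $ i" using pos by (simp add: less_imp_le)
    thus "x $ i * y $ k \<le> (1 + \<theta>) * (x $ k * y $ i)"
      using bound[of i k] by (simp add: distrib_right)
  qed
  ultimately show ?thesis by blast
qed

text \<open>The spread inequality is taken at the indices attaining the maximal and the minimal
  ratio. A bound linear in \<open>\<theta>\<close> lets geometric decay of the spread pass directly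
  to the distance.\<close>

lemma hilbert_dist_le:
  fixes x y :: "real ^ 'n"
  assumes "pos_vec x" "pos_vec y" "0 \<le> \<theta>" "ratio_spread_le x y \<theta>"
  shows "hilbert_dist x y \<le> \<theta>"
proof -
  let ?r = "\<lambda>i. x $ i / y $ i"
  have pos: "0 < x $ i" "0 < y $ i" for i using assms by (auto simp: pos_vec_def)
  have "Max (range ?r) \<in> range ?r" "Min (range ?r) \<in> range ?r"
    by (auto intro!: Max_in Min_in)
  then obtain i k where i: "Max (range ?r) = ?r i" and k: "Min (range ?r) = ?r k"
    by (elim rangeE)
  have "x $ i * y $ k / (y $ i * y $ k) \<le> (1 + \<theta>) * (x $ k * y $ i) / (y $ i * y $ k)"
    using ratio_spread_leD[OF assms(4)] pos by (intro divide_right_mono) (simp_all add: less_imp_le)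
  hence "?r i \<le> (1 + \<theta>) * ?r k" using pos[of i] pos[of k] by simp
  hence "ln (?r i) \<le> ln ((1 + \<theta>) * ?r k)"
    using pos by (intro ln_mono) simp_all
  also have "\<dots> = ln (1 + \<theta>) + ln (?r k)"
    using assms(3) pos[of k] by (intro ln_mult_pos) auto
  also have "\<dots> \<le> \<theta> + ln (?r k)"
    using assms(3) ln_add_one_self_le_self by simp
  finally show ?thesis by (simp add: hilbert_dist_def i k)
qed

lemma pos_vec_ediv: "pos_vec a \<Longrightarrow> pos_vec x \<Longrightarrow> pos_vec (a \<oslash> x)"
  by (simp add: pos_vec_def ediv_def)

lemma ediv_mult: "pos_vec y \<Longrightarrow> (x \<oslash> y) $ i * y $ i = x $ i"
  by (simp add: pos_vec_def ediv_def less_imp_neq[THEN not_sym])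

text \<open>The factors from \<open>a\<close> cancel and inversion exchanges the indices: the claim
  at \<open>(i, k)\<close> is the hypothesis at \<open>(k, i)\<close>.\<close>

lemma ratio_spread_le_ediv:
  assumes "pos_vec a" "pos_vec x" "pos_vec y" "ratio_spread_le x y \<theta>"
  shows "ratio_spread_le (a \<oslash> x) (a \<oslash> y) \<theta>"
  unfolding ratio_spread_le_def
proof (intro allI)
  fix i k
  have pos: "0 < a $ i" "0 < x $ i" "0 < y $ i" for i using assms by (auto simp: pos_vec_def)
  have "a $ i * a $ k * (x $ k * y $ i) / (x $ i * y $ k * x $ k * y $ i)
      \<le> a $ i * a $ k * ((1 + \<theta>) * (x $ i * y $ k)) / (x $ i * y $ k * x $ k * y $ i)"
    using ratio_spread_leD[OF assms(4), of k i] pos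
    by (intro divide_right_mono mult_left_mono) (auto simp: less_imp_le)
  thus "(a \<oslash> x) $ i * (a \<oslash> y) $ k \<le> (1 + \<theta>) * ((a \<oslash> x) $ k * (a \<oslash> y) $ i)"
    using pos[of i] pos[of k] by (simp add: ediv_def field_simps)
qed

text \<open>One positive entry of \<open>v\<close> suffices because every row of \<open>K\<close> is
  positive. This covers boundary points of the simplex, where Brouwer's theorem is applied.\<close>

lemma positive_matrix_vector_mult:
  fixes K :: "real ^ 'n ^ 'm"
  assumes "\<forall>i j. 0 < K $ i $ j" "\<forall>j. 0 \<le> v $ j" "0 < (\<Sum>j\<in>UNIV. v $ j)"
  shows "pos_vec (K *v v)"
proof -
  have "\<exists>j. v $ j \<noteq> 0"
    using assms(3) by (metis less_irrefl sum.neutral)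
  then obtain j where "0 < v $ j" using assms(2) by (metis order_le_less)
  hence "0 < (\<Sum>j\<in>UNIV. K $ i $ j * v $ j)" for i
    using assms(1,2) by (intro sum_pos2[of _ j]) (auto simp: less_imp_le)
  thus ?thesis by (simp add: pos_vec_def matrix_vector_mult_def)
qed

lemma pos_vec_matrix_vector_mult:
  fixes K :: "real ^ 'n ^ 'm"
  assumes "\<forall>i j. 0 < K $ i $ j" "pos_vec v"
  shows "pos_vec (K *v v)"
  using assms by (intro positive_matrix_vector_mult) (auto simp: pos_vec_def less_imp_le intro!: sum_pos)

text \<open>Expanding both sides into double sums reduces the claim to comparing entries of row
  \<open>i\<close>. Divided out, it bounds the ratio of \<open>K *v z\<close> to
  \<open>K *v y\<close> below by \<open>\<delta>\<close> times the ratio of the total sums, the same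
  bound for every such row.\<close>

lemma common_mass:
  fixes K :: "real ^ 'n ^ 'm"
  assumes "\<And>j k. \<delta> * K $ i $ j \<le> K $ i $ k" "\<forall>j. 0 \<le> z $ j" "pos_vec y"
  shows "\<delta> * (\<Sum>j\<in>UNIV. z $ j) * (K *v y) $ i \<le> (K *v z) $ i * (\<Sum>j\<in>UNIV. y $ j)"
proof -
  have "\<delta> * (\<Sum>j\<in>UNIV. z $ j) * (K *v y) $ i
      = (\<Sum>k\<in>UNIV. \<Sum>j\<in>UNIV. (\<delta> * K $ i $ j) * (z $ k * y $ j))"
    by (subst sum.swap) (simp add: matrix_vector_mult_def sum_product sum_distrib_left mult_ac)
  also have "\<dots> \<le> (\<Sum>k\<in>UNIV. \<Sum>j\<in>UNIV. K $ i $ k * (z $ k * y $ j))"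
    using assms by (intro sum_mono mult_right_mono) (auto simp: pos_vec_def less_imp_le)
  also have "\<dots> = (K *v z) $ i * (\<Sum>j\<in>UNIV. y $ j)"
    by (subst sum.swap) (simp add: matrix_vector_mult_def sum_product mult_ac)
  finally show ?thesis .
qed

lemma ratio_spread_le_matrix_vector_mult:
  fixes K :: "real ^ 'n ^ 'm"
  assumes K: "\<forall>i j. 0 < K $ i $ j"
    and \<delta>: "\<And>i j k. \<delta> * K $ i $ j \<le> K $ i $ k" and "\<delta> \<le> 1"
    and x: "pos_vec x" and y: "pos_vec y" and "0 \<le> \<theta>" and spread: "ratio_spread_le x y \<theta>"
  shows "ratio_spread_le (K *v x) (K *v y) ((1 - \<delta>) * \<theta>)"
  unfolding ratio_spread_le_def
proof (intro allI)
  fix i l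
  have pos: "0 < x $ i" "0 < y $ i" for i using x y by (auto simp: pos_vec_def)
  define \<mu> where "\<mu> = Min (range (\<lambda>i. x $ i / y $ i))"
  have "\<mu> \<in> range (\<lambda>i. x $ i / y $ i)" unfolding \<mu>_def by (intro Min_in) auto
  then obtain p where p: "\<mu> = x $ p / y $ p" by blast
  have "\<mu> \<le> x $ k / y $ k" for k unfolding \<mu>_def by (intro Min_le) auto
  hence low: "\<mu> * y $ k \<le> x $ k" for k using pos by (simp add: pos_le_divide_eq)
  \<comment> \<open>\<open>p\<close> attains the minimal ratio, so comparison with \<open>p\<close>
    bounds every ratio by \<open>(1 + \<theta>) * \<mu>\<close>.\<close>
  have up: "x $ k \<le> (1 + \<theta>) * \<mu> * y $ k" for k
    using ratio_spread_leD[OF spread, of k p] pos[of p] by (simp add: p field_simps)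
  define S where "S = (\<Sum>j\<in>UNIV. y $ j)"
  have S: "0 < S" unfolding S_def using pos by (intro sum_pos) auto
  define X where "X = (\<Sum>j\<in>UNIV. x $ j)"
  have Ky: "0 < (K *v y) $ i" for i
    using pos_vec_matrix_vector_mult[OF K y] by (simp add: pos_vec_def)
  \<comment> \<open>The nonnegative gaps of \<open>x\<close> to its lower and upper barrier.
    \<open>common_mass\<close> is applied to \<open>z\<close> in row \<open>l\<close>, whose ratio
    needs a lower bound, and to \<open>w\<close> in row \<open>i\<close>, whose ratio needs an upper
    bound.\<close>
  define z where "z = x - \<mu> *\<^sub>R y"
  define w where "w = ((1 + \<theta>) * \<mu>) *\<^sub>R y - x"
  have "\<delta> * (\<Sum>j\<in>UNIV. z $ j) * (K *v y) $ l \<le> (K *v z) $ l * S"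
    unfolding S_def using low by (intro common_mass \<delta> y) (simp add: z_def)
  hence 1: "\<delta> * (X - \<mu> * S) * (K *v y) $ l \<le> ((K *v x) $ l - \<mu> * (K *v y) $ l) * S"
    by (simp add: z_def X_def S_def sum_subtractf sum_distrib_left matrix_vector_mult_diff_distrib
        matrix_vector_mult_scaleR)
  have "\<delta> * (\<Sum>j\<in>UNIV. w $ j) * (K *v y) $ i \<le> (K *v w) $ i * S"
    unfolding S_def using up by (intro common_mass \<delta> y) (simp add: w_def)
  hence 2: "\<delta> * ((1 + \<theta>) * \<mu> * S - X) * (K *v y) $ i
      \<le> ((1 + \<theta>) * \<mu> * (K *v y) $ i - (K *v x) $ i) * S"
    by (simp add: w_def X_def S_def sum_subtractf sum_distrib_left matrix_vector_mult_diff_distrib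
        matrix_vector_mult_scaleR)
  define r where "r = (\<lambda>i. (K *v x) $ i / (K *v y) $ i)"
  have Kx: "(K *v x) $ i = r i * (K *v y) $ i" for i
    using Ky[of i] by (simp add: r_def)
  have "(\<delta> * (X - \<mu> * S)) * (K *v y) $ l \<le> ((r l - \<mu>) * S) * (K *v y) $ l"
    using 1 by (simp add: Kx algebra_simps)
  hence 1: "\<delta> * (X - \<mu> * S) \<le> (r l - \<mu>) * S" using Ky[of l] by simp
  have "(\<delta> * ((1 + \<theta>) * \<mu> * S - X)) * (K *v y) $ i \<le> (((1 + \<theta>) * \<mu> - r i) * S) * (K *v y) $ i"
    using 2 by (simp add: Kx algebra_simps)
  hence 2: "\<delta> * ((1 + \<theta>) * \<mu> * S - X) \<le> ((1 + \<theta>) * \<mu> - r i) * S" using Ky[of i] by simp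
  \<comment> \<open>Adding the two bounds cancels \<open>X\<close> and leaves
    \<open>\<delta> * \<theta> * \<mu> * S\<close> on the left.\<close>
  have "(r i - r l) * S \<le> ((1 - \<delta>) * \<theta> * \<mu>) * S"
    using 1 2 by (simp add: algebra_simps)
  hence diff: "r i - r l \<le> (1 - \<delta>) * \<theta> * \<mu>" using S by simp
  \<comment> \<open>The consequence \<open>\<mu> \<le> r l\<close> turns the bound on the difference
    of ratios into one on their quotient.\<close>
  have "(K *v (\<mu> *\<^sub>R y)) $ l \<le> (K *v x) $ l"
    using K low unfolding matrix_vector_mult_def
    by (auto intro!: sum_mono mult_left_mono simp: less_imp_le)
  hence "\<mu> * (K *v y) $ l \<le> r l * (K *v y) $ l" by (simp add: Kx matrix_vector_mult_scaleR)
  hence "\<mu> \<le> r l" using Ky[of l] by simp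
  hence "(1 - \<delta>) * \<theta> * \<mu> \<le> (1 - \<delta>) * \<theta> * r l"
    using assms(3,6) by (intro mult_left_mono) auto
  hence "r i \<le> (1 + (1 - \<delta>) * \<theta>) * r l" using diff by (simp add: algebra_simps)
  hence "r i * ((K *v y) $ i * (K *v y) $ l) \<le> (1 + (1 - \<delta>) * \<theta>) * r l * ((K *v y) $ i * (K *v y) $ l)"
    using Ky by (intro mult_right_mono) (auto simp: less_imp_le)
  thus "(K *v x) $ i * (K *v y) $ l \<le> (1 + (1 - \<delta>) * \<theta>) * ((K *v x) $ l * (K *v y) $ i)"
    by (simp add: Kx mult_ac)
qed

text \<open>Arbitrary entries are compared, not only those of one row, so that a single
  \<open>\<delta>\<close> serves both \<open>K\<close> and its transpose.\<close>

lemma positive_matrix_entry_ratio: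
  fixes K :: "real ^ 'n ^ 'm"
  assumes "\<forall>i j. 0 < K $ i $ j"
  obtains \<delta> where "0 < \<delta>" "\<delta> < 1" "\<And>i j k l. \<delta> * K $ i $ j \<le> K $ k $ l"
proof -
  define f where "f = (\<lambda>(i, j). K $ i $ j)"
  have in_rng: "Min (range f) \<in> range f" "Max (range f) \<in> range f"
    by (auto intro!: Min_in Max_in)
  have pos: "0 < Min (range f)" "0 < Max (range f)"
    using in_rng assms by (metis (mono_tags, lifting) f_def imageE split_beta)+
  have le: "Min (range f) \<le> f p" "f p \<le> Max (range f)" for p by auto
  \<comment> \<open>The factor 1/2 makes \<open>\<delta> < 1\<close> strict even if all entries are
    equal, so that the rate \<open>1 - \<delta>\<close> is positive.\<close>
  define \<delta> where "\<delta> = Min (range f) / Max (range f) / 2"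
  show thesis
  proof
    show "0 < \<delta>" using pos by (simp add: \<delta>_def)
    have "Min (range f) < Max (range f) * 2" using pos order_trans[OF le] by linarith
    thus "\<delta> < 1" using pos by (simp add: \<delta>_def divide_simps)
    fix i j k l
    have "\<delta> * K $ i $ j \<le> \<delta> * Max (range f)"
      using le(2)[of "(i, j)"] \<open>0 < \<delta>\<close> by (simp add: f_def)
    also have "\<dots> \<le> Min (range f)" using pos by (simp add: \<delta>_def)
    also have "\<dots> \<le> K $ k $ l" using le(1)[of "(k, l)"] by (simp add: f_def)
    finally show "\<delta> * K $ i $ j \<le> K $ k $ l" .
  qed
qed

lemma sinkhorn_step_contracts:
  fixes K :: "real ^ 'n ^ 'm"
  assumes K: "\<forall>i j. 0 < K $ i $ j"
    and \<delta>: "\<And>i j k. \<delta> * K $ i $ j \<le> K $ i $ k" "\<delta> \<le> 1"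
    and "pos_vec a" "pos_vec x" "pos_vec y" "0 \<le> \<theta>" "ratio_spread_le x y \<theta>"
  shows "pos_vec (a \<oslash> (K *v x))"
    and "ratio_spread_le (a \<oslash> (K *v x)) (a \<oslash> (K *v y)) ((1 - \<delta>) * \<theta>)"
proof -
  have Kx: "pos_vec (K *v x)" and Ky: "pos_vec (K *v y)"
    using assms by (blast intro: pos_vec_matrix_vector_mult)+
  show "pos_vec (a \<oslash> (K *v x))" using assms(4) Kx by (rule pos_vec_ediv)
  show "ratio_spread_le (a \<oslash> (K *v x)) (a \<oslash> (K *v y)) ((1 - \<delta>) * \<theta>)"
    using ratio_spread_le_matrix_vector_mult[OF K \<delta> assms(5-8)]
    by (rule ratio_spread_le_ediv[OF assms(4) Kx Ky])
qed

text \<open>Both half-steps reproduce the fixed point, so comparing an iterate with it is an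
  instance of \<open>sinkhorn_step_contracts\<close>, once with \<open>K\<close> and once with its
  transpose.\<close>

lemma sinkhorn_spread:
  fixes K :: "real ^ 'n ^ 'n"
  assumes K: "\<forall>i j. 0 < K $ i $ j"
    and \<delta>: "\<And>i j k l. \<delta> * K $ i $ j \<le> K $ k $ l" "0 < \<delta>" "\<delta> < 1"
    and a: "pos_vec a" and b: "pos_vec b" and u0: "pos_vec u0" and v0: "pos_vec v0"
    and fp: "sinkhorn_fixed_point K a b us vs"
    and \<theta>: "0 \<le> \<theta>" "ratio_spread_le u0 us \<theta>" "ratio_spread_le v0 vs \<theta>"
  shows "pos_vec (fst (sinkhorn K a b u0 v0 t)) \<and> pos_vec (snd (sinkhorn K a b u0 v0 t))
    \<and> ratio_spread_le (fst (sinkhorn K a b u0 v0 t)) us (\<theta> * (1 - \<delta>) ^ t)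
    \<and> ratio_spread_le (snd (sinkhorn K a b u0 v0 t)) vs (\<theta> * (1 - \<delta>) ^ t)"
proof (induction t)
  case 0
  show ?case using u0 v0 \<theta> by simp
next
  case (Suc t)
  let ?v = "snd (sinkhorn K a b u0 v0 t)"
  let ?u' = "a \<oslash> (K *v ?v)"
  let ?v' = "b \<oslash> (transpose K *v ?u')"
  have us: "pos_vec us" "us = a \<oslash> (K *v vs)" and vs: "pos_vec vs" "vs = b \<oslash> (transpose K *v us)"
    using fp unfolding sinkhorn_fixed_point_def by blast+
  have nonneg: "0 \<le> \<theta> * (1 - \<delta>) ^ k" for k using \<theta> \<delta> by simp
  have v: "pos_vec ?v" "ratio_spread_le ?v vs (\<theta> * (1 - \<delta>) ^ t)" using Suc.IH by blast+
  have u': "pos_vec ?u'" "ratio_spread_le ?u' us (\<theta> * (1 - \<delta>) ^ Suc t)"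
    using sinkhorn_step_contracts[OF K \<delta>(1) less_imp_le[OF \<delta>(3)] a v(1) vs(1) nonneg v(2)]
    by (simp_all add: mult.left_commute flip: us(2))
  have KT: "\<forall>i j. 0 < transpose K $ i $ j" using K by (simp add: transpose_def)
  have \<delta>T: "\<delta> * transpose K $ i $ j \<le> transpose K $ i $ k" for i j k
    using \<delta>(1) by (simp add: transpose_def)
  have v': "pos_vec ?v'" "ratio_spread_le ?v' vs ((1 - \<delta>) * (\<theta> * (1 - \<delta>) ^ Suc t))"
    using sinkhorn_step_contracts[OF KT \<delta>T less_imp_le[OF \<delta>(3)] b u'(1) us(1) nonneg u'(2)]
    by (simp_all only: vs(2)[symmetric])
  \<comment> \<open>The second half-step gains a further factor \<open>1 - \<delta>\<close>, given
    up here so that \<open>u\<close> and \<open>v\<close> share one bound.\<close>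
  have "(1 - \<delta>) * (\<theta> * (1 - \<delta>) ^ Suc t) \<le> 1 * (\<theta> * (1 - \<delta>) ^ Suc t)"
    using \<delta>(2) by (intro mult_right_mono nonneg) simp
  hence "ratio_spread_le ?v' vs (\<theta> * (1 - \<delta>) ^ Suc t)"
    unfolding mult_1 by (rule ratio_spread_le_mono[OF v'(1) vs(1) v'(2)])
  thus ?case using u' v' by (simp add: Let_def)
qed

text \<open>The rate is \<open>1 - \<delta>\<close>, and \<open>M\<close> adds the initial spreads
  of both vectors. The spread bounds stay in the conclusion because uniqueness passes to the limit
  in them.\<close>

lemma sinkhorn_linear_convergence:
  fixes K :: "real ^ 'n ^ 'n"
  assumes K: "\<forall>i j. 0 < K $ i $ j"
    and a: "pos_vec a" and b: "pos_vec b" and u0: "pos_vec u0" and v0: "pos_vec v0"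
    and fp: "sinkhorn_fixed_point K a b us vs"
  shows "\<exists>M \<gamma>. 0 \<le> M \<and> 0 < \<gamma> \<and> \<gamma> < 1 \<and>
      (\<forall>t. ratio_spread_le (fst (sinkhorn K a b u0 v0 t)) us (M * \<gamma> ^ t)
         \<and> ratio_spread_le (snd (sinkhorn K a b u0 v0 t)) vs (M * \<gamma> ^ t)
         \<and> hilbert_dist (fst (sinkhorn K a b u0 v0 t)) us \<le> M * \<gamma> ^ t
         \<and> hilbert_dist (snd (sinkhorn K a b u0 v0 t)) vs \<le> M * \<gamma> ^ t)"
proof -
  obtain \<delta> where \<delta>: "0 < \<delta>" "\<delta> < 1" "\<And>i j k l. \<delta> * K $ i $ j \<le> K $ k $ l"
    using positive_matrix_entry_ratio[OF K] by blast
  have us: "pos_vec us" and vs: "pos_vec vs"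
    using fp unfolding sinkhorn_fixed_point_def by blast+
  obtain \<theta> \<theta>' where \<theta>: "0 \<le> \<theta>" "ratio_spread_le u0 us \<theta>"
    and \<theta>': "0 \<le> \<theta>'" "ratio_spread_le v0 vs \<theta>'"
    using ex_ratio_spread_le[OF u0 us] ex_ratio_spread_le[OF v0 vs] by blast
  have M: "0 \<le> \<theta> + \<theta>'" "ratio_spread_le u0 us (\<theta> + \<theta>')" "ratio_spread_le v0 vs (\<theta> + \<theta>')"
    using \<theta> \<theta>' ratio_spread_le_mono[OF u0 us \<theta>(2)] ratio_spread_le_mono[OF v0 vs \<theta>'(2)] by auto
  note spread = sinkhorn_spread[OF K \<delta>(3,1,2) a b u0 v0 fp M]
  have nonneg: "0 \<le> (\<theta> + \<theta>') * (1 - \<delta>) ^ t" for t using M \<delta> by simp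
  show ?thesis
    using spread M(1) \<delta> us vs nonneg
    by (intro exI[of _ "\<theta> + \<theta>'"] exI[of _ "1 - \<delta>"]) (auto intro!: hilbert_dist_le)
qed

subsection \<open>Fixed points\<close>

text \<open>Exchanging \<open>i\<close> and \<open>k\<close> turns the inequality into an equality,
  so all ratios agree with the one at an arbitrary index.\<close>

lemma ratio_spread_zero_imp_scaleR:
  fixes x y :: "real ^ 'n"
  assumes x: "pos_vec x" and y: "pos_vec y" and spread: "ratio_spread_le x y 0"
  shows "\<exists>s>0. x = s *\<^sub>R y"
proof (intro exI conjI)
  define p :: 'n where "p = undefined"
  have pos: "0 < x $ i" "0 < y $ i" for i using x y by (auto simp: pos_vec_def)
  show "0 < x $ p / y $ p" using pos by simp
  have "x $ i * y $ p = x $ p * y $ i" for i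
    using ratio_spread_leD[OF spread, of i p] ratio_spread_leD[OF spread, of p i] by simp
  thus "x = (x $ p / y $ p) *\<^sub>R y"
    using pos[of p] by (simp add: vec_eq_iff field_simps)
qed

lemma sinkhorn_fixed_point_scaleR:
  assumes "sinkhorn_fixed_point K a b u v" "0 < s"
  shows "sinkhorn_fixed_point K a b (inverse s *\<^sub>R u) (s *\<^sub>R v)"
proof -
  have fp: "pos_vec u" "pos_vec v" "u = a \<oslash> (K *v v)" "v = b \<oslash> (transpose K *v u)"
    using assms(1) unfolding sinkhorn_fixed_point_def by blast+
  have ediv: "x \<oslash> (c *\<^sub>R y) = inverse c *\<^sub>R (x \<oslash> y)" for x y :: "real ^ 'n" and c
    by (simp add: ediv_def vec_eq_iff field_simps)
  show ?thesis
    using fp(1,2) assms(2) fp(3,4)[symmetric]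
    by (simp add: sinkhorn_fixed_point_def matrix_vector_mult_scaleR ediv pos_vec_def)
qed

lemma sinkhorn_at_fixed_point:
  assumes "sinkhorn_fixed_point K a b u v"
  shows "sinkhorn K a b u v t = (u, v)"
proof -
  have "a \<oslash> (K *v v) = u" "b \<oslash> (transpose K *v u) = v"
    using assms unfolding sinkhorn_fixed_point_def by (blast intro: sym)+
  thus ?thesis by (induction t) (simp_all add: Let_def)
qed

text \<open>Started at \<open>(u, v)\<close>, the iteration stays there, while linear convergence
  towards the other fixed point bounds the spread of \<open>v\<close> against \<open>vs\<close> by a
  null sequence.\<close>

lemma sinkhorn_fixed_point_unique:
  fixes K :: "real ^ 'n ^ 'n"
  assumes K: "\<forall>i j. 0 < K $ i $ j" and a: "pos_vec a" and b: "pos_vec b"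
    and fp: "sinkhorn_fixed_point K a b us vs" and fp': "sinkhorn_fixed_point K a b u v"
  shows "\<exists>s>0. u = inverse s *\<^sub>R us \<and> v = s *\<^sub>R vs"
proof -
  have pos: "pos_vec u" "pos_vec v" "pos_vec vs"
    using fp fp' unfolding sinkhorn_fixed_point_def by blast+
  obtain M \<gamma> where \<gamma>: "0 < \<gamma>" "\<gamma> < 1"
    and spread: "\<And>t. ratio_spread_le v vs (M * \<gamma> ^ t)"
    using sinkhorn_linear_convergence[OF K a b pos(1,2) fp]
    by (auto simp: sinkhorn_at_fixed_point[OF fp'])
  have "ratio_spread_le v vs 0"
    unfolding ratio_spread_le_def
  proof (intro allI)
    fix i k
    have "(\<lambda>t. (1 + M * \<gamma> ^ t) * (v $ k * vs $ i)) \<longlonglongrightarrow> (1 + M * 0) * (v $ k * vs $ i)"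
      using \<gamma> by (intro tendsto_intros LIMSEQ_realpow_zero) auto
    thus "v $ i * vs $ k \<le> (1 + 0) * (v $ k * vs $ i)"
      using spread by (intro LIMSEQ_le_const) (auto simp: ratio_spread_le_def)
  qed
  then obtain s where s: "0 < s" "v = s *\<^sub>R vs"
    using ratio_spread_zero_imp_scaleR pos by blast
  \<comment> \<open>Two fixed points with the same second component \<open>v\<close> agree, since
    the first component is \<open>a \<oslash> (K *v v)\<close>.\<close>
  have "sinkhorn_fixed_point K a b (inverse s *\<^sub>R us) v"
    using sinkhorn_fixed_point_scaleR[OF fp s(1)] s(2) by simp
  hence "u = inverse s *\<^sub>R us"
    using fp' unfolding sinkhorn_fixed_point_def by metis
  thus ?thesis using s by blast
qed

lemma sinkhorn_fixed_point_exists: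
  fixes K :: "real ^ 'n ^ 'n"
  assumes K: "\<forall>i j. 0 < K $ i $ j" and a: "pos_vec a" and b: "pos_vec b"
    and mass: "(\<Sum>i\<in>UNIV. a $ i) = (\<Sum>i\<in>UNIV. b $ i)"
  shows "\<exists>u v. sinkhorn_fixed_point K a b u v"
proof -
  \<comment> \<open>The closed simplex is compact. Entries may vanish on its boundary, yet
    \<open>K *v v\<close>, and hence \<open>W v\<close>, is strictly positive there.\<close>
  define S :: "(real ^ 'n) set" where "S = {v. (\<forall>i. 0 \<le> v $ i) \<and> (\<Sum>i\<in>UNIV. v $ i) = 1}"
  define U where "U v = a \<oslash> (K *v v)" for v
  define W where "W v = b \<oslash> (transpose K *v U v)" for v
  define f where "f v = (1 / (\<Sum>i\<in>UNIV. W v $ i)) *\<^sub>R W v" for v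
  have Kv: "pos_vec (K *v v)" if "v \<in> S" for v
    using that by (intro positive_matrix_vector_mult[OF K]) (auto simp: S_def)
  have U: "pos_vec (U v)" if "v \<in> S" for v
    unfolding U_def using Kv[OF that] a by (intro pos_vec_ediv)
  have KU: "pos_vec (transpose K *v U v)" if "v \<in> S" for v
    using U[OF that] K by (intro pos_vec_matrix_vector_mult) (auto simp: transpose_def)
  have W: "pos_vec (W v)" if "v \<in> S" for v
    unfolding W_def using KU[OF that] b by (intro pos_vec_ediv)
  have sumW: "0 < (\<Sum>i\<in>UNIV. W v $ i)" if "v \<in> S" for v
    using W[OF that] by (intro sum_pos) (auto simp: pos_vec_def)
  have contU: "continuous_on S U"
    unfolding U_def ediv_def
    using Kv by (intro continuous_intros) (auto simp: pos_vec_def less_imp_neq[THEN not_sym])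
  have contKU: "continuous_on S (\<lambda>v. transpose K *v U v)"
    by (intro linear_continuous_on_compose[OF contU] matrix_vector_mul_linear)
  have contW: "continuous_on S W"
    unfolding W_def ediv_def
    using KU by (intro continuous_intros contKU) (auto simp: pos_vec_def less_imp_neq[THEN not_sym])
  have contf: "continuous_on S f"
    unfolding f_def
    using sumW by (intro continuous_intros contW) (auto simp: less_imp_neq[THEN not_sym])
  have maps: "f \<in> S \<rightarrow> S"
    using W sumW
    by (auto simp: S_def f_def pos_vec_def less_imp_le sum_divide_distrib[symmetric]
        less_imp_neq[THEN not_sym])
  have "convex S"
    unfolding S_def convex_alt
    by (auto simp: sum.distrib sum_distrib_left[symmetric])
  moreover have "compact S"
  proof -
    have "norm v \<le> 1" if "v \<in> S" for v
      using norm_le_l1_cart[of v] that by (simp add: S_def)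
    hence "bounded S" by (auto simp: bounded_iff)
    moreover have "closed S"
      unfolding S_def by (intro closed_Collect_conj closed_Collect_all closed_Collect_le
          closed_Collect_eq continuous_intros)
    ultimately show ?thesis by (simp add: compact_eq_bounded_closed)
  qed
  moreover have "S \<noteq> {}"
  proof -
    have "(\<chi> i. 1 / real CARD('n)) \<in> S" by (simp add: S_def)
    thus ?thesis by blast
  qed
  ultimately obtain v where v: "v \<in> S" "f v = v"
    using brouwer[OF _ _ _ contf] maps by blast
  define \<rho> where "\<rho> = (\<Sum>i\<in>UNIV. W v $ i)"
  have \<rho>: "0 < \<rho>" using sumW v by (simp add: \<rho>_def)
  have Wv: "W v = \<rho> *\<^sub>R v"
  proof -
    have "\<rho> *\<^sub>R f v = W v" using \<rho> by (simp add: f_def \<rho>_def)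
    thus ?thesis using v by simp
  qed
  \<comment> \<open>The pairing of \<open>W v\<close> with \<open>transpose K *v U v\<close> is
    evaluated twice: entrywise it gives the mass of \<open>b\<close>, and by adjointness
    \<open>\<rho>\<close> times the mass of \<open>a\<close>.\<close>
  have "(\<Sum>i\<in>UNIV. b $ i) = (\<Sum>i\<in>UNIV. W v $ i * (transpose K *v U v) $ i)"
    using KU[OF v(1)] by (intro sum.cong) (auto simp: W_def ediv_def pos_vec_def less_imp_neq[THEN not_sym])
  also have "\<dots> = \<rho> * (v \<bullet> (transpose K *v U v))"
    by (simp add: Wv inner_vec_def sum_distrib_left mult_ac)
  also have "v \<bullet> (transpose K *v U v) = U v \<bullet> (K *v v)"
    by (metis dot_lmul_matrix inner_commute transpose_matrix_vector)
  also have "U v \<bullet> (K *v v) = (\<Sum>i\<in>UNIV. a $ i)"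
    unfolding inner_vec_def
    using Kv[OF v(1)] by (intro sum.cong) (auto simp: U_def ediv_def pos_vec_def less_imp_neq[THEN not_sym])
  finally have "(\<Sum>i\<in>UNIV. a $ i) = \<rho> * (\<Sum>i\<in>UNIV. a $ i)" using mass by simp
  moreover have "0 < (\<Sum>i\<in>UNIV. a $ i)" using a by (intro sum_pos) (auto simp: pos_vec_def)
  ultimately have "\<rho> = 1" by simp
  hence "W v = v" using Wv by simp
  \<comment> \<open>Positivity of \<open>W v = v\<close> shows that the fixed point lies off the
    boundary of the simplex.\<close>
  hence "sinkhorn_fixed_point K a b (U v) v"
    using U W v(1) by (metis U_def W_def sinkhorn_fixed_point_def)
  thus ?thesis by blast
qed

subsection \<open>Optimality\<close>

text \<open>The derivative of \<open>p * (ln p - 1)\<close> is \<open>ln p\<close>. For positive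
  \<open>p\<close> the claim is \<open>ln x \<le> x - 1\<close> at \<open>x = q / p\<close>; at
  \<open>p = 0\<close> it reads \<open>- q \<le> 0\<close>.\<close>

lemma entropy_tangent:
  fixes p q :: real
  assumes "0 \<le> p" "0 < q"
  shows "q * (ln q - 1) + (p - q) * ln q \<le> p * (ln p - 1)"
proof (cases "p = 0")
  case False
  hence p: "0 < p" using assms by simp
  have "p * ln (q / p) \<le> p * (q / p - 1)"
    using p assms by (intro mult_left_mono ln_le_minus_one) auto
  thus ?thesis using p assms by (simp add: ln_div algebra_simps)
qed (use assms in \<open>simp add: algebra_simps\<close>)

lemma transport_plan_row_sum: "transport_plan a b P \<Longrightarrow> (\<Sum>j\<in>UNIV. P $ i $ j) = a $ i"
  by (auto simp: transport_plan_def matrix_vector_mult_def)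

lemma transport_plan_col_sum: "transport_plan a b P \<Longrightarrow> (\<Sum>i\<in>UNIV. P $ i $ j) = b $ j"
  by (auto simp: transport_plan_def matrix_vector_mult_def transpose_def)

lemma diag_mat_mult_nth: "(diag_mat u ** K ** diag_mat v) $ i $ j = u $ i * K $ i $ j * v $ j"
  by (simp add: diag_mat_def matrix_matrix_mult_def if_distrib if_distribR cong: if_cong)

lemma sinkhorn_plan_optimal:
  fixes C :: "real ^ 'n ^ 'n"
  assumes \<epsilon>: "0 < \<epsilon>" and K: "K = gibbs_kernel C \<epsilon>" and a: "pos_vec a" and b: "pos_vec b"
    and fp: "sinkhorn_fixed_point K a b u v"
  shows "solves_entropic_ot C \<epsilon> a b (diag_mat u ** K ** diag_mat v)"
proof -
  define Q where "Q = diag_mat u ** K ** diag_mat v"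
  have pos: "0 < u $ i" "0 < v $ i" for i
    using fp unfolding sinkhorn_fixed_point_def pos_vec_def by blast+
  have Q_nth: "Q $ i $ j = u $ i * K $ i $ j * v $ j" for i j
    by (simp add: Q_def diag_mat_mult_nth)
  have K_pos: "0 < K $ i $ j" for i j by (simp add: K gibbs_kernel_def)
  have Q_pos: "0 < Q $ i $ j" for i j using pos K_pos by (simp add: Q_nth)
  have fp': "pos_vec u" "pos_vec v" "u = a \<oslash> (K *v v)" "v = b \<oslash> (transpose K *v u)"
    using fp unfolding sinkhorn_fixed_point_def by blast+
  \<comment> \<open>With positive denominators the fixed point equations can be multiplied out; the
    products are the row and column sums of \<open>Q\<close>.\<close>
  have "pos_vec (K *v v)" "pos_vec (transpose K *v u)"
    using K_pos fp'(1,2) by (auto intro!: pos_vec_matrix_vector_mult simp: transpose_def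
        simp del: transpose_matrix_vector)
  hence "u $ i * (K *v v) $ i = a $ i" "v $ j * (transpose K *v u) $ j = b $ j" for i j
    using ediv_mult[of "K *v v" a i] ediv_mult[of "transpose K *v u" b j]
    by (simp_all only: fp'(3,4)[symmetric])
  hence Q: "transport_plan a b Q"
    using Q_pos
    by (simp add: transport_plan_def vec_eq_iff matrix_vector_mult_def transpose_def Q_nth
        sum_distrib_left mult_ac less_imp_le)
  have "entropic_cost C \<epsilon> Q \<le> entropic_cost C \<epsilon> P" if P: "transport_plan a b P" for P
  proof -
    let ?\<phi> = "\<lambda>P i j. P $ i $ j * C $ i $ j + \<epsilon> * (P $ i $ j * (ln (P $ i $ j) - 1))"
    have cost: "entropic_cost C \<epsilon> P = (\<Sum>i\<in>UNIV. \<Sum>j\<in>UNIV. ?\<phi> P i j)" for P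
      by (simp add: entropic_cost_def sum.distrib sum_distrib_left)
    \<comment> \<open>The slope is the partial derivative of the cost at \<open>Q\<close>, expressed
      through the potentials \<open>\<epsilon> * ln (u $ i)\<close> and
      \<open>\<epsilon> * ln (v $ j)\<close>.\<close>
    have tangent: "?\<phi> Q i j + (P $ i $ j - Q $ i $ j) * (\<epsilon> * ln (u $ i) + \<epsilon> * ln (v $ j)) \<le> ?\<phi> P i j" for i j
    proof -
      have "ln (Q $ i $ j) = ln (u $ i) + ln (v $ j) - C $ i $ j / \<epsilon>"
        using pos(1)[of i] pos(2)[of j] by (simp add: Q_nth K gibbs_kernel_def ln_mult)
      hence grad: "\<epsilon> * ln (u $ i) + \<epsilon> * ln (v $ j) = C $ i $ j + \<epsilon> * ln (Q $ i $ j)"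
        using \<epsilon> by (simp add: field_simps)
      have "0 \<le> P $ i $ j" using P by (simp add: transport_plan_def)
      hence "\<epsilon> * (Q $ i $ j * (ln (Q $ i $ j) - 1) + (P $ i $ j - Q $ i $ j) * ln (Q $ i $ j))
          \<le> \<epsilon> * (P $ i $ j * (ln (P $ i $ j) - 1))"
        using Q_pos \<epsilon> by (intro mult_left_mono entropy_tangent) auto
      thus ?thesis unfolding grad by (simp add: algebra_simps)
    qed
    \<comment> \<open>\<open>P\<close> and \<open>Q\<close> share their marginals, so the linear
      term sums to zero: the row potentials directly, the column potentials after exchanging the
      sums.\<close>
    have row: "(\<Sum>i\<in>UNIV. \<Sum>j\<in>UNIV. (P $ i $ j - Q $ i $ j) * (\<epsilon> * ln (u $ i))) = 0"
      by (simp add: sum_distrib_right[symmetric] sum_subtractf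
          transport_plan_row_sum[OF P] transport_plan_row_sum[OF Q])
    have "(\<Sum>i\<in>UNIV. \<Sum>j\<in>UNIV. (P $ i $ j - Q $ i $ j) * (\<epsilon> * ln (v $ j)))
        = (\<Sum>j\<in>UNIV. \<Sum>i\<in>UNIV. (P $ i $ j - Q $ i $ j) * (\<epsilon> * ln (v $ j)))"
      by (rule sum.swap)
    also have "\<dots> = 0"
      by (simp add: sum_distrib_right[symmetric] sum_subtractf
          transport_plan_col_sum[OF P] transport_plan_col_sum[OF Q])
    finally have "(\<Sum>i\<in>UNIV. \<Sum>j\<in>UNIV. ?\<phi> Q i j)
        = (\<Sum>i\<in>UNIV. \<Sum>j\<in>UNIV.
            ?\<phi> Q i j + (P $ i $ j - Q $ i $ j) * (\<epsilon> * ln (u $ i) + \<epsilon> * ln (v $ j)))"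
      using row by (simp add: sum.distrib distrib_left)
    also have "\<dots> \<le> (\<Sum>i\<in>UNIV. \<Sum>j\<in>UNIV. ?\<phi> P i j)"
      by (intro sum_mono tangent)
    finally show ?thesis by (simp add: cost)
  qed
  thus ?thesis
    using Q by (auto simp: solves_entropic_ot_def is_arg_min_def Q_def not_less)
qed

theorem proposition1:
  fixes C K :: "real ^ 'n ^ 'n" and \<epsilon> :: real
    and a b u0 v0 :: "real ^ 'n"
    and I :: "'c::finite \<Rightarrow> 'n set" and m :: nat
  assumes "\<epsilon> > 0"
    and "K = gibbs_kernel C \<epsilon>"
    and "pos_vec a" and "pos_vec b"
    and "(\<Sum>i\<in>UNIV. a $ i) = (\<Sum>i\<in>UNIV. b $ i)"
    and "CARD('n) = CARD('c) * m"
    and "disjoint_family I" and "(\<Union>j. I j) = UNIV" and "\<And>j. card (I j) = m"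
    and "pos_vec u0" and "pos_vec v0"
  shows "(\<forall>t. all_to_all_sinkhorn K a b I u0 v0 t = sinkhorn K a b u0 v0 t)
    \<and> (\<forall>t. star_sinkhorn K a b I u0 v0 t = sinkhorn K a b u0 v0 t)
    \<and> (\<exists>us vs. sinkhorn_fixed_point K a b us vs)
    \<and> (\<forall>us vs. sinkhorn_fixed_point K a b us vs \<longrightarrow>
        (\<forall>u v. sinkhorn_fixed_point K a b u v \<longleftrightarrow>
            (\<exists>s>0. u = inverse s *\<^sub>R us \<and> v = s *\<^sub>R vs))
      \<and> (\<exists>M \<gamma>. 0 \<le> M \<and> 0 < \<gamma> \<and> \<gamma> < 1 \<and>
            (\<forall>t. hilbert_dist (fst (sinkhorn K a b u0 v0 t)) us \<le> M * \<gamma> ^ t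
               \<and> hilbert_dist (snd (sinkhorn K a b u0 v0 t)) vs \<le> M * \<gamma> ^ t))
      \<and> solves_entropic_ot C \<epsilon> a b (diag_mat us ** K ** diag_mat vs))"
proof -
  have K: "\<forall>i j. 0 < K $ i $ j" using assms(2) by (simp add: gibbs_kernel_def)
  note a = assms(3) and b = assms(4) and mass = assms(5) and u0 = assms(10) and v0 = assms(11)
  have "\<exists>M \<gamma>. 0 \<le> M \<and> 0 < \<gamma> \<and> \<gamma> < 1 \<and>
      (\<forall>t. hilbert_dist (fst (sinkhorn K a b u0 v0 t)) us \<le> M * \<gamma> ^ t
         \<and> hilbert_dist (snd (sinkhorn K a b u0 v0 t)) vs \<le> M * \<gamma> ^ t)"
    if "sinkhorn_fixed_point K a b us vs" for us vs
    using sinkhorn_linear_convergence[OF K a b u0 v0 that] by blast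
  moreover have "sinkhorn_fixed_point K a b u v \<longleftrightarrow>
      (\<exists>s>0. u = inverse s *\<^sub>R us \<and> v = s *\<^sub>R vs)"
    if "sinkhorn_fixed_point K a b us vs" for us vs u v
    using sinkhorn_fixed_point_unique[OF K a b that] sinkhorn_fixed_point_scaleR[OF that] by blast
  ultimately show ?thesis
    using all_to_all_sinkhorn_eq[OF assms(7,8)] star_sinkhorn_eq[OF assms(7,8)]
      sinkhorn_fixed_point_exists[OF K a b mass] sinkhorn_plan_optimal[OF assms(1,2) a b]
    by simp
qed

end
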